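(* Let points $q_0,q_1\in M$ satisfy $q_1\in J^+(q_0)$. Then there exists an optimal trajectory from $q_0$ to $q_1$, i.e. an admissible trajectory connecting $q_0$ to $q_1$ whose length is maximal among all admissible trajectories connecting $q_0$ to $q_1$.
   Context: Let $M=\mathbb R^3$ with coordinates $(x,y,z)$, $X_1=\frac{\partial}{\partial x}$, $X_2=\frac{\partial}{\partial y}+\frac{x^2}{2}\frac{\partial}{\partial z}$, $U_1=\{(u_1,u_2)\in\mathbb R^2: u_2\ge|u_1|\}$. An admissible trajectory is a Lipschitz curve $q:[0,t_1]\to M$ ($t_1\ge0$ free) such that $\dot q=u_1X_1(q)+u_2X_2(q)$ a.e. for some bounded measurable control $u=(u_1,u_2):[0,t_1]\to U_1$. Its length is $l(q(\cdot))=\int_0^{t_1}\sqrt{u_2^2-u_1^2}\,dt$. For $q_0\in M$, the causal future $J^+(q_0)$ is the set of endpoints $q(t_1)$ of admissible trajectories with $q(0)=q_0$. *)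

theory Defs
  imports "HOL-Analysis.Analysis"
begin

definition X1 :: "real^3 \<Rightarrow> real^3" where
  "X1 q = vector [1, 0, 0]"

definition X2 :: "real^3 \<Rightarrow> real^3" where
  "X2 q = vector [0, 1, (q $ 1)\<^sup>2 / 2]"

definition U1 :: "(real^2) set" where
  "U1 = {u. u $ 2 \<ge> \<bar>u $ 1\<bar>}"

text \<open>
  Only the values of \<open>q\<close> and \<open>u\<close> on \<open>{0..t1}\<close> matter; measurability and
  ``almost everywhere'' are with respect to Lebesgue measure on \<open>{0..t1}\<close>.
\<close>

definition is_control :: "real \<Rightarrow> (real \<Rightarrow> real^3) \<Rightarrow> (real \<Rightarrow> real^2) \<Rightarrow> bool" where
  "is_control t1 q u \<longleftrightarrow>
     u \<in> borel_measurable (lebesgue_on {0..t1}) \<and>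
     bounded (u ` {0..t1}) \<and>
     u ` {0..t1} \<subseteq> U1 \<and>
     (AE t in lebesgue_on {0..t1}.
        (q has_vector_derivative (u t $ 1 *\<^sub>R X1 (q t) + u t $ 2 *\<^sub>R X2 (q t)))
          (at t within {0..t1}))"

definition admissible_trajectory :: "real \<Rightarrow> (real \<Rightarrow> real^3) \<Rightarrow> bool" where
  "admissible_trajectory t1 q \<longleftrightarrow>
     0 \<le> t1 \<and> (\<exists>L. L-lipschitz_on {0..t1} q) \<and> (\<exists>u. is_control t1 q u)"

definition control_length :: "real \<Rightarrow> (real \<Rightarrow> real^2) \<Rightarrow> real" where
  "control_length t1 u = (LINT t|lebesgue_on {0..t1}. sqrt ((u t $ 2)\<^sup>2 - (u t $ 1)\<^sup>2))"

text \<open>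
  The control of an admissible trajectory is unique up to null sets, so the choice below
  does not affect the length; see \<open>traj_length_eq\<close>.
\<close>

definition traj_length :: "real \<Rightarrow> (real \<Rightarrow> real^3) \<Rightarrow> real" where
  "traj_length t1 q = control_length t1 (SOME u. is_control t1 q u)"

lemma is_control_unique_AE:
  assumes "is_control t1 q u" "is_control t1 q v"
  shows "AE t in lebesgue_on {0..t1}. u t = v t"
proof (cases "0 < t1")
  case True
  have u: "AE t in lebesgue_on {0..t1}.
        (q has_vector_derivative (u t $ 1 *\<^sub>R X1 (q t) + u t $ 2 *\<^sub>R X2 (q t)))
          (at t within {0..t1})"
    and v: "AE t in lebesgue_on {0..t1}.
        (q has_vector_derivative (v t $ 1 *\<^sub>R X1 (q t) + v t $ 2 *\<^sub>R X2 (q t)))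
          (at t within {0..t1})"
    using assms by (simp_all add: is_control_def)
  show ?thesis
    using u v AE_space
  proof eventually_elim
    case (elim t)
    then have "t \<in> cbox 0 t1"
      by simp
    then have eq: "u t $ 1 *\<^sub>R X1 (q t) + u t $ 2 *\<^sub>R X2 (q t) =
               v t $ 1 *\<^sub>R X1 (q t) + v t $ 2 *\<^sub>R X2 (q t)"
      using vector_derivative_unique_within_closed_interval[OF True, of t q] elim by simp
    show ?case
      using arg_cong[OF eq, of "\<lambda>w. w $ 1"] arg_cong[OF eq, of "\<lambda>w. w $ 2"]
      by (simp add: X1_def X2_def vec_eq_iff forall_2)
  qed
next
  case False
  then have "negligible {0..t1}"
    using negligible_sing[of "0::real"] by (cases "t1 = 0") auto
  then have "AE t in lebesgue. t \<notin> {0..t1}"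
    by (intro AE_not_in) (simp add: negligible_iff_null_sets)
  then have "AE t in lebesgue. t \<in> {0..t1} \<longrightarrow> u t = v t"
    by (rule eventually_mono) blast
  then show ?thesis
    by (subst AE_restrict_space_iff) auto
qed

lemma traj_length_eq:
  assumes u: "is_control t1 q u"
  shows "traj_length t1 q = control_length t1 u"
proof -
  define v where "v = (SOME u. is_control t1 q u)"
  have v: "is_control t1 q v"
    unfolding v_def using u by (rule someI[of "is_control t1 q"])
  have comp: "(\<lambda>t. w t $ i) \<in> borel_measurable (lebesgue_on {0..t1})"
    if "is_control t1 q w" for w i
  proof (rule borel_measurable_continuous_on[where f = "\<lambda>x. x $ i"])
    show "continuous_on UNIV (\<lambda>x :: real^2. x $ i)"
      by (intro continuous_intros)
    show "w \<in> borel_measurable (lebesgue_on {0..t1})"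
      using that by (simp add: is_control_def)
  qed
  note [measurable] = comp[OF u] comp[OF v]
  have "AE t in lebesgue_on {0..t1}.
      sqrt ((v t $ 2)\<^sup>2 - (v t $ 1)\<^sup>2) = sqrt ((u t $ 2)\<^sup>2 - (u t $ 1)\<^sup>2)"
    using is_control_unique_AE[OF v u] by eventually_elim simp
  then show ?thesis
    unfolding traj_length_def control_length_def v_def[symmetric]
    by (intro integral_cong_AE) measurable
qed

definition causal_future :: "real^3 \<Rightarrow> (real^3) set" where
  "causal_future q0 = {q t1 | t1 q. admissible_trajectory t1 q \<and> q 0 = q0}"

definition connects :: "real \<Rightarrow> (real \<Rightarrow> real^3) \<Rightarrow> real^3 \<Rightarrow> real^3 \<Rightarrow> bool" where
  "connects t1 q q0 q1 \<longleftrightarrow> admissible_trajectory t1 q \<and> q 0 = q0 \<and> q t1 = q1"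

definition optimal_trajectory :: "real \<Rightarrow> (real \<Rightarrow> real^3) \<Rightarrow> real^3 \<Rightarrow> real^3 \<Rightarrow> bool" where
  "optimal_trajectory t1 q q0 q1 \<longleftrightarrow>
     connects t1 q q0 q1 \<and>
     (\<forall>s1 p. connects s1 p q0 q1 \<longrightarrow> traj_length s1 p \<le> traj_length t1 q)"

end

theory Submission
  imports Defs "HOL-Complex_Analysis.Great_Picard"
begin

text \<open>
  Along a trajectory \<open>(x, y, z)\<close> the cone condition reads \<open>\<bar>x'\<bar> \<le> y'\<close>, so \<open>x\<close> is a 1-Lipschitz
  function \<open>f\<close> of \<open>y\<close>. In terms of this profile the end point condition for \<open>z\<close> is that the
  integral of \<open>f\<^sup>2 / 2\<close> over \<open>[y0, y1]\<close> equals \<open>z1 - z0\<close>, and the length is the integral of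
  \<open>sqrt (1 - f'\<^sup>2)\<close>. The free terminal time disappears, because length is invariant under
  reparametrisation. What remains is to maximise a concave functional over a set of profiles that is
  compact for uniform convergence by the Arzela--Ascoli theorem.
  
  The length functional is upper semicontinuous because it is an infimum of continuous ones. By the
  reverse triangle inequality a causal curve is no longer than any polygon inscribed in it
  (\<open>trajectory_imp_profile\<close>), and the length of such a polygon depends continuously on \<open>f\<close>. For the
  trajectory built over a given profile, the lengths of finer and finer polygons converge to its
  length (\<open>profile_imp_trajectory\<close>). So if the profiles of a maximising sequence converge to \<open>g\<close>,
  every polygon inscribed in \<open>g\<close> is at least as long as the supremum of all lengths, hence so is the
  trajectory over \<open>g\<close>.
  
  Passing between curves and integrals requires that Lipschitz functions on the line are almost
  everywhere differentiable and are integrals of their derivatives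
  (\<open>lipschitz_real_AE_derivative\<close>). This follows from the Radon--Nikodym theorem and Lebesgue's
  differentiation theorem. It provides the control of the limit curve, about whose derivative uniform
  convergence alone says nothing.
\<close>

section \<open>Lipschitz functions of one real variable\<close>

lemma negligible_minus_image:
  fixes N :: "real set" assumes "negligible N" shows "negligible (uminus ` N)"
  by (rule negligible_differentiable_image_negligible[OF _ assms])
    (auto intro: differentiable_on_minus differentiable_on_id)

text \<open>
  Lebesgue's differentiation theorem. The continuity statement for averages over the intervals
  \<open>[x, x + h]\<close> controls only difference quotients to the right; those to the left are the right
  ones of the reflected function \<open>\<lambda>x. g (- x)\<close>, whose exceptional set is reflected as well.
\<close>

lemma AE_primitive_has_real_derivative:
  fixes F g :: "real \<Rightarrow> real"
  assumes I: "\<And>a b. a \<le> b \<Longrightarrow> (g has_integral F b - F a) {a..b}"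
  obtains N where "negligible N" "\<And>x. x \<notin> N \<Longrightarrow> (F has_real_derivative g x) (at x)"
proof -
  have int: "g integrable_on cbox a b" for a b
  proof (cases "a \<le> b")
    case True
    then show ?thesis using I by (auto simp: cbox_interval integrable_on_def)
  qed auto
  then have int': "(\<lambda>x. g (- x)) integrable_on cbox a b" for a b
    using integrable_reflect[of g "-a" "-b"] by simp
  obtain N where N: "negligible N"
    "\<And>x e. \<lbrakk>x \<notin> N; 0 < e\<rbrakk> \<Longrightarrow> \<exists>d>0. \<forall>h. 0 < h \<and> h < d \<longrightarrow>
        norm (integral (cbox x (x + h *\<^sub>R One)) g /\<^sub>R h ^ DIM(real) - g x) < e"
    using integrable_ccontinuous_explicit[OF int] by blast
  obtain M where M: "negligible M"
    "\<And>x e. \<lbrakk>x \<notin> M; 0 < e\<rbrakk> \<Longrightarrow> \<exists>d>0. \<forall>h. 0 < h \<and> h < d \<longrightarrow>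
        norm (integral (cbox x (x + h *\<^sub>R One)) (\<lambda>x. g (- x)) /\<^sub>R h ^ DIM(real) - g (- x)) < e"
    using integrable_ccontinuous_explicit[OF int'] by blast
  show thesis
  proof
    show "negligible (N \<union> uminus ` M)"
      using N(1) M(1) by (simp add: negligible_minus_image)
    fix x assume x: "x \<notin> N \<union> uminus ` M"
    then have xM: "- x \<notin> M" by force
    show "(F has_real_derivative g x) (at x)"
      unfolding DERIV_def LIM_eq
    proof (intro allI impI)
      fix e :: real assume e: "0 < e"
      obtain d1 where d1: "d1 > 0" "\<And>h. 0 < h \<Longrightarrow> h < d1 \<Longrightarrow>
          norm (integral (cbox x (x + h *\<^sub>R One)) g /\<^sub>R h ^ DIM(real) - g x) < e"
        using N(2)[of x e] x e by blast
      obtain d2 where d2: "d2 > 0" "\<And>h. 0 < h \<Longrightarrow> h < d2 \<Longrightarrow>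
          norm (integral (cbox (-x) (-x + h *\<^sub>R One)) (\<lambda>x. g (- x)) /\<^sub>R h ^ DIM(real) - g x) < e"
        using M(2)[OF xM e] by auto
      have "norm ((F (x + h) - F x) / h - g x) < e" if "h \<noteq> 0" "norm h < min d1 d2" for h
      proof (cases "0 < h")
        case True
        have "integral {x..x + h} g = F (x + h) - F x"
          using I[of x "x + h"] True by (simp add: integral_unique)
        then show ?thesis using d1(2)[of h] True that
          by (simp add: cbox_interval divide_inverse mult.commute)
      next
        case False
        then have h: "0 < - h" "- h < d2" using that by auto
        have "((\<lambda>x. g (- x)) has_integral F x - F (x + h)) {- x..- (x + h)}"
          using I[of "x + h" x] h has_integral_reflect_real[of g "F x - F (x + h)" x "x + h"] by simp
        then have "integral {- x..- x - h} (\<lambda>x. g (- x)) = F x - F (x + h)"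
          by (simp add: integral_unique)
        moreover have "(F (x + h) - F x) / h = (F x - F (x + h)) / (- h)"
          using h by (simp add: divide_simps)
        ultimately show ?thesis using d2(2)[OF h]
          by (simp add: cbox_interval divide_inverse mult.commute)
      qed
      then show "\<exists>s>0. \<forall>xa. xa \<noteq> 0 \<and> norm (xa - 0) < s \<longrightarrow> norm ((F (x + xa) - F x) / xa - g x) < e"
        using d1(1) d2(1) by (intro exI[of _ "min d1 d2"]) auto
    qed
  qed
qed

text \<open>
  The measure with distribution function \<open>G\<close> is the image of Lebesgue measure under the inverse
  of \<open>G\<close>, which exists because \<open>G\<close> grows at least as fast as the identity. The upper Lipschitz
  bound makes \<open>G\<close> map null sets to null sets, which is exactly absolute continuity of this
  measure, and \<open>g\<close> is its Radon--Nikodym density.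
\<close>

lemma bilipschitz_real_density:
  fixes G :: "real \<Rightarrow> real"
  assumes low: "\<And>x y. x \<le> y \<Longrightarrow> y - x \<le> G y - G x"
    and lip: "L-lipschitz_on UNIV G"
  obtains g where "g \<in> borel_measurable borel"
    "\<And>a b. a \<le> b \<Longrightarrow> (g has_integral G b - G a) {a..b}"
proof -
  have cont: "continuous_on UNIV G"
    using lip by (rule lipschitz_on_continuous_on)
  have sm: "G x < G y \<longleftrightarrow> x < y" for x y
    using low[of x y] low[of y x] by linarith
  then have le: "G x \<le> G y \<longleftrightarrow> x \<le> y" for x y
    by (meson not_le)
  have inj: "inj G"
    by (metis injI order_class.order_eq_iff le)
  have surj: "surj G"
  proof -
    have "\<exists>x. G x = y" for y
    proof -
      let ?r = "\<bar>y - G 0\<bar>"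
      have "\<exists>x\<ge>- ?r. x \<le> ?r \<and> G x = y"
        using low[of 0 ?r] low[of "- ?r" 0] 
        by (intro IVT') (auto intro: continuous_on_subset[OF cont])
      then show ?thesis by blast
    qed
    then show ?thesis by (metis surjI)
  qed
  define H where "H = inv G"
  have GH: "G (H y) = y" and HG: "H (G x) = x" for x y
    using inj surj by (simp_all add: H_def surj_f_inv_f)
  have "mono H"
    by (rule monoI) (metis GH le)
  then have Hm[measurable]: "H \<in> borel_measurable lborel"
    using borel_measurable_mono by simp
  define \<nu> where "\<nu> = distr lborel lborel H"
  have sets: "sets \<nu> = sets lborel"
    by (simp add: \<nu>_def)
  have em: "emeasure \<nu> {a..b} = ennreal (G b - G a)" if "a \<le> b" for a b
  proof -
    have "H -` {a..b} = {G a..G b}"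
      by (auto) (metis GH le)+
    then show ?thesis
      using that le[of a b] by (simp add: \<nu>_def emeasure_distr)
  qed
  have ac: "absolutely_continuous lborel \<nu>"
    unfolding absolutely_continuous_def
  proof
    fix N assume N: "N \<in> null_sets (lborel :: real measure)"
    then have [measurable]: "N \<in> sets borel" by auto
    have "negligible N"
      using N by (simp add: negligible_iff_null_sets null_sets_completionI)
    then have "negligible (G ` N)"
    proof (rule negligible_locally_Lipschitz_image[rotated])
      show "\<exists>T B. open T \<and> x \<in> T \<and> (\<forall>y\<in>N \<inter> T. norm (G y - G x) \<le> B * norm (y - x))" for x
        using lipschitz_on_normD[OF lip] by (intro exI[of _ UNIV] exI[of _ L]) auto
    qed simp
    moreover have "H -` N = G ` N"
      proof safe
      fix y assume "H y \<in> N"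
      then show "y \<in> G ` N" by (metis GH imageI)
    qed (simp add: HG)
    moreover have "H -` N \<in> sets lborel"
      using measurable_sets[OF Hm, of N] by simp
    ultimately have "H -` N \<in> null_sets lborel"
      by (metis negligible_iff_null_sets null_sets_completion_iff)
    then show "N \<in> null_sets \<nu>"
      by (auto simp: \<nu>_def null_sets_def emeasure_distr)
  qed
  obtain f where f[measurable]: "f \<in> borel_measurable lborel" and d: "density lborel f = \<nu>"
    using sigma_finite_measure.Radon_Nikodym[OF sigma_finite_lborel ac sets] by blast
  show thesis
  proof
    show "(\<lambda>x. enn2real (f x)) \<in> borel_measurable borel"
      using f by simp
    fix a b :: real assume ab: "a \<le> b"
    have eq: "(\<integral>\<^sup>+x. f x * indicator {a..b} x \<partial>lborel) = ennreal (G b - G a)"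
      using em[OF ab] by (simp flip: d add: emeasure_density)
    then have "AE x in lborel. f x * indicator {a..b} x \<noteq> \<infinity>"
      by (intro nn_integral_noteq_infinite) auto
    then have "(\<integral>\<^sup>+x. ennreal (enn2real (f x) * indicator {a..b} x) \<partial>lborel)
        = (\<integral>\<^sup>+x. f x * indicator {a..b} x \<partial>lborel)"
      by (intro nn_integral_cong_AE) (auto simp: indicator_def less_top)
    then have "((\<lambda>x. enn2real (f x) * indicator {a..b} x) has_integral (G b - G a)) UNIV"
      using low[OF ab] ab f eq by (intro nn_integral_has_integral) auto
    then have "((\<lambda>x. if x \<in> {a..b} then enn2real (f x) else 0) has_integral (G b - G a)) UNIV"
      by (rule has_integral_eq[rotated]) (auto simp: indicator_def)
    then show "((\<lambda>x. enn2real (f x)) has_integral G b - G a) {a..b}"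
      by (simp only: has_integral_restrict_UNIV)
  qed
qed

lemma lipschitz_has_real_derivative_bound:
  fixes F :: "real \<Rightarrow> real"
  assumes F: "C-lipschitz_on UNIV F" and D: "(F has_real_derivative d) (at x)"
  shows "\<bar>d\<bar> \<le> C"
proof (rule tendsto_upperbound)
  show "((\<lambda>h. \<bar>(F (x + h) - F x) / h\<bar>) \<longlongrightarrow> \<bar>d\<bar>) (at 0)"
    using D unfolding DERIV_def by (rule tendsto_rabs)
  have "\<bar>F (x + h) - F x\<bar> \<le> C * \<bar>h\<bar>" for h
    using lipschitz_on_normD[OF F, of "x + h" x] by simp
  then show "\<forall>\<^sub>F h in at 0. \<bar>(F (x + h) - F x) / h\<bar> \<le> C"
    by (simp add: eventually_at_filter abs_divide divide_simps)
qed simp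

text \<open>
  Rademacher's theorem on the line together with the fundamental theorem of calculus. Adding a
  steep linear function to \<open>F\<close> makes it bi-Lipschitz and increasing, so that it has a density,
  and the density is the derivative almost everywhere. Since the derivative is bounded by \<open>C\<close>,
  truncating the density at height \<open>C\<close> changes it only on a null set; the result is a Borel
  function that satisfies the bound everywhere, as an admissible control must.
\<close>

lemma lipschitz_real_AE_derivative:
  fixes F :: "real \<Rightarrow> real"
  assumes F: "C-lipschitz_on UNIV F"
  obtains g N where "g \<in> borel_measurable borel" "\<And>x. \<bar>g x\<bar> \<le> C"
    "negligible N" "\<And>x. x \<notin> N \<Longrightarrow> (F has_real_derivative g x) (at x)"
    "\<And>a b. a \<le> b \<Longrightarrow> (g has_integral F b - F a) {a..b}"
proof -
  have C: "0 \<le> C" using F by (rule lipschitz_on_nonneg)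
  define G where "G x = F x + (C + 1) * x" for x
  have low: "y - x \<le> G y - G x" if "x \<le> y" for x y
  proof -
    have "\<bar>F y - F x\<bar> \<le> C * (y - x)"
      using lipschitz_on_normD[OF F, of y x] that by simp
    then have "- (F y - F x) \<le> C * (y - x)" by linarith
    then show ?thesis by (simp add: G_def algebra_simps)
  qed
  have "(C + \<bar>C + 1\<bar> * 1)-lipschitz_on UNIV G"
    unfolding G_def by (intro lipschitz_intros F)
  from bilipschitz_real_density[OF low this] obtain g0 where
    g0: "g0 \<in> borel_measurable borel" "\<And>a b. a \<le> b \<Longrightarrow> (g0 has_integral G b - G a) {a..b}"
    by blast
  define g1 where "g1 x = g0 x - (C + 1)" for x
  have g1: "(g1 has_integral F b - F a) {a..b}" if "a \<le> b" for a b
  proof -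
    have "((\<lambda>x. g0 x - (C + 1)) has_integral (G b - G a) - (b - a) * (C + 1)) {a..b}"
      using has_integral_diff[OF g0(2)[OF that] has_integral_const_real[of "C + 1" a b]]
      using that by simp
    then show ?thesis using that by (simp add: g1_def[abs_def] G_def algebra_simps)
  qed
  obtain N where N: "negligible N" "\<And>x. x \<notin> N \<Longrightarrow> (F has_real_derivative g1 x) (at x)"
    using AE_primitive_has_real_derivative[OF g1] by blast
  define g where "g x = max (- C) (min C (g1 x))" for x
  have eq: "g x = g1 x" if "x \<notin> N" for x
    using lipschitz_has_real_derivative_bound[OF F N(2)[OF that]] by (auto simp: g_def)
  show thesis
  proof
    show "g \<in> borel_measurable borel" unfolding g_def g1_def using g0(1) by measurable
    show "\<bar>g x\<bar> \<le> C" for x using C by (auto simp: g_def)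
    show "negligible N" by fact
    show "(F has_real_derivative g x) (at x)" if "x \<notin> N" for x
      using N(2)[OF that] eq[OF that] by simp
    show "(g has_integral F b - F a) {a..b}" if "a \<le> b" for a b
      using g1[OF that] by (rule has_integral_spike[OF N(1), rotated]) (auto simp: eq)
  qed
qed

lemma AE_lebesgue_on_iff_negligible:
  assumes "S \<in> sets lebesgue"
  shows "(AE t in lebesgue_on S. P t) \<longleftrightarrow> (\<exists>N. negligible N \<and> (\<forall>t\<in>S - N. P t))"
proof -
  have "(AE t in lebesgue_on S. P t) \<longleftrightarrow> (AE t in lebesgue. t \<in> S \<longrightarrow> P t)"
    using assms by (subst AE_restrict_space_iff) auto
  also have "\<dots> \<longleftrightarrow> negligible {t. \<not> (t \<in> S \<longrightarrow> P t)}"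
    by (simp add: completion.AE_iff_null_sets negligible_iff_null_sets)
  also have "\<dots> \<longleftrightarrow> (\<exists>N. negligible N \<and> (\<forall>t\<in>S - N. P t))"
    by (auto intro: negligible_subset)
  finally show ?thesis .
qed

text \<open>
  Extending a function from an interval by its end values makes the results for functions on the
  whole line applicable.
\<close>

lemma lipschitz_on_clamp:
  fixes f :: "real \<Rightarrow> 'a::metric_space"
  assumes f: "C-lipschitz_on {a..b} f" and "a \<le> b"
  shows "C-lipschitz_on UNIV (\<lambda>x. f (max a (min b x)))"
proof (rule lipschitz_onI)
  fix x y :: real
  have "dist (f (max a (min b x))) (f (max a (min b y))) \<le> C * dist (max a (min b x)) (max a (min b y))"
    using \<open>a \<le> b\<close> by (intro lipschitz_onD[OF f]) auto
  also have "\<dots> \<le> C * dist x y"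
    using lipschitz_on_nonneg[OF f] by (intro mult_left_mono) (auto simp: dist_real_def)
  finally show "dist (f (max a (min b x))) (f (max a (min b y))) \<le> C * dist x y" .
qed (rule lipschitz_on_nonneg[OF f])

lemma has_real_derivative_clamp:
  fixes F f :: "real \<Rightarrow> real"
  assumes "((\<lambda>x. f (max a (min b x))) has_real_derivative d) (at t)" "t \<in> {a..b}"
  shows "(f has_real_derivative d) (at t within {a..b})"
proof -
  have "((\<lambda>x. f (max a (min b x))) has_real_derivative d) (at t within {a..b})"
    using assms(1) by (rule has_field_derivative_at_within)
  then show ?thesis
    by (rule has_field_derivative_transform_within[OF _ zero_less_one assms(2)]) auto
qed

text \<open>
  The given almost everywhere derivative agrees almost everywhere with the one provided by
  Rademacher's theorem for the clamped extension, and only interior points matter for this.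
\<close>

lemma lipschitz_fundamental_theorem_of_calculus:
  fixes f u :: "real \<Rightarrow> real"
  assumes f: "C-lipschitz_on {a..b} f" and ab: "a \<le> b" and N: "negligible N"
    and D: "\<And>t. t \<in> {a..b} - N \<Longrightarrow> (f has_real_derivative u t) (at t within {a..b})"
  shows "(u has_integral f b - f a) {a..b}"
proof -
  obtain g M where g: "negligible M"
    "\<And>x. x \<notin> M \<Longrightarrow> ((\<lambda>x. f (max a (min b x))) has_real_derivative g x) (at x)"
    "\<And>c d. c \<le> d \<Longrightarrow> (g has_integral f (max a (min b d)) - f (max a (min b c))) {c..d}"
    by (rule lipschitz_real_AE_derivative[OF lipschitz_on_clamp[OF f ab]]) blast
  show ?thesis
  proof (rule has_integral_spike)
    show "negligible (N \<union> M \<union> {a, b})" using N g(1) by simp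
    show "(g has_integral f b - f a) {a..b}"
      using g(3)[OF ab] ab by simp
    fix t assume t: "t \<in> {a..b} - (N \<union> M \<union> {a, b})"
    then have "(f has_real_derivative g t) (at t within {a..b})"
      by (intro has_real_derivative_clamp g(2)) auto
    moreover have "(f has_real_derivative u t) (at t within {a..b})"
      using D t by auto
    moreover have "at t within {a..b} = at t"
      using t by (intro at_within_interior) auto
    ultimately show "u t = g t"
      by (metis DERIV_unique)
  qed
qed

section \<open>The reverse triangle inequality for the length\<close>

text \<open>
  Jensen's inequality for the concave function \<open>(v, w) \<mapsto> sqrt (v\<^sup>2 - w\<^sup>2)\<close> on the cone: a
  straight timelike chord is at least as long as any causal curve with the same end points. For the
  timelike vector \<open>(A, B)\<close> it is the integral of the reverse Cauchy--Schwarz inequality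
  \<open>sqrt (v\<^sup>2 - w\<^sup>2) * sqrt (A\<^sup>2 - B\<^sup>2) \<le> v * A - w * B\<close>.
\<close>

lemma has_integral_sqrt_diff_squares_le:
  fixes v w :: "real \<Rightarrow> real"
  assumes v: "(v has_integral A) S" and w: "(w has_integral B) S"
    and I: "((\<lambda>t. sqrt ((v t)\<^sup>2 - (w t)\<^sup>2)) has_integral I) S"
    and vw: "\<And>t. t \<in> S \<Longrightarrow> \<bar>w t\<bar> \<le> v t"
  shows "\<bar>B\<bar> \<le> A" and "I \<le> sqrt (A\<^sup>2 - B\<^sup>2)"
proof -
  have "B \<le> A"
    using vw by (intro has_integral_le[OF w v]) force
  moreover have "- B \<le> A"
    using vw by (intro has_integral_le[OF has_integral_neg[OF w] v]) force
  ultimately show BA: "\<bar>B\<bar> \<le> A" by linarith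
  \<comment> \<open>Enlarging \<open>A\<close> by \<open>e\<close> makes \<open>(A + e, B)\<close> strictly timelike, so that \<open>D > 0\<close> can be cancelled.\<close>
  have le: "I \<le> sqrt ((A + e)\<^sup>2 - B\<^sup>2)" if e: "0 < e" for e
  proof -
    define D where "D = sqrt ((A + e)\<^sup>2 - B\<^sup>2)"
    have "B\<^sup>2 < (A + e)\<^sup>2"
      using BA e by (intro power2_strict_mono) auto
    then have D: "0 < D" "D\<^sup>2 = (A + e)\<^sup>2 - B\<^sup>2" by (auto simp: D_def)
    have "I * D \<le> A * (A + e) - B * B"
    proof (rule has_integral_le)
      show "((\<lambda>t. sqrt ((v t)\<^sup>2 - (w t)\<^sup>2) * D) has_integral I * D) S"
        by (rule has_integral_mult_left[OF I])
      show "((\<lambda>t. v t * (A + e) - w t * B) has_integral A * (A + e) - B * B) S"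
        by (intro has_integral_diff has_integral_mult_left v w)
      fix t assume t: "t \<in> S"
      have "\<bar>w t * B\<bar> \<le> v t * (A + e)"
        unfolding abs_mult using vw[OF t] BA e by (intro mult_mono) auto
      then have "0 \<le> v t * (A + e) - w t * B" by linarith
      moreover have "((v t)\<^sup>2 - (w t)\<^sup>2) * ((A + e)\<^sup>2 - B\<^sup>2) \<le> (v t * (A + e) - w t * B)\<^sup>2"
      proof -
        have "(v t * (A + e) - w t * B)\<^sup>2 - ((v t)\<^sup>2 - (w t)\<^sup>2) * ((A + e)\<^sup>2 - B\<^sup>2)
            = (w t * (A + e) - v t * B)\<^sup>2"
          by (simp add: power2_eq_square algebra_simps)
        then show ?thesis by (metis diff_ge_0_iff_ge zero_le_power2)
      qed
      ultimately show "sqrt ((v t)\<^sup>2 - (w t)\<^sup>2) * D \<le> v t * (A + e) - w t * B"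
        unfolding D_def real_sqrt_mult[symmetric] by (intro real_le_lsqrt) auto
    qed
    also have "\<dots> \<le> D * D"
      using BA e by (simp add: power2_eq_square[symmetric] D(2)) 
        (simp add: power2_eq_square algebra_simps)
    finally have "I \<le> D" using D(1) by simp
    then show ?thesis by (simp add: D_def)
  qed
  show "I \<le> sqrt (A\<^sup>2 - B\<^sup>2)"
  proof (rule tendsto_lowerbound)
    have "((\<lambda>e. sqrt ((A + e)\<^sup>2 - B\<^sup>2)) \<longlongrightarrow> sqrt ((A + 0)\<^sup>2 - B\<^sup>2)) (at_right 0)"
      by (intro tendsto_intros)
    then show "((\<lambda>e. sqrt ((A + e)\<^sup>2 - B\<^sup>2)) \<longlongrightarrow> sqrt (A\<^sup>2 - B\<^sup>2)) (at_right 0)"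
      by simp
    show "\<forall>\<^sub>F e in at_right 0. I \<le> sqrt ((A + e)\<^sup>2 - B\<^sup>2)"
      using le by (auto simp: eventually_at_filter)
  qed simp
qed

section \<open>Profiles and inscribed polygons\<close>

text \<open>
  The Lorentzian length of the polygon inscribed in the graph of \<open>f\<close> over \<open>n\<close> equal subintervals
  of \<open>[a, b]\<close>. It depends continuously on finitely many values of \<open>f\<close>, unlike the length of the
  graph itself, which involves the derivative.
\<close>

definition chord_sum :: "nat \<Rightarrow> (real \<Rightarrow> real) \<Rightarrow> real \<Rightarrow> real \<Rightarrow> real" where
  "chord_sum n f a b = (\<Sum>k<n. sqrt (((b - a) / n)\<^sup>2 -
     (f (a + real (Suc k) * ((b - a) / n)) - f (a + real k * ((b - a) / n)))\<^sup>2))"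

text \<open>
  The projections to the \<open>(x, y)\<close> plane of the trajectories from \<open>q0\<close> to \<open>q1\<close>, as graphs over
  the \<open>y\<close> axis. The inclusion of the velocity in the cone becomes the Lipschitz constant 1, and the
  equation for the third coordinate becomes one integral constraint.
\<close>

definition profile :: "real^3 \<Rightarrow> real^3 \<Rightarrow> (real \<Rightarrow> real) \<Rightarrow> bool" where
  "profile q0 q1 f \<longleftrightarrow> 1-lipschitz_on {q0 $ 2..q1 $ 2} f \<and> f (q0 $ 2) = q0 $ 1 \<and> f (q1 $ 2) = q1 $ 1 \<and>
     ((\<lambda>s. (f s)\<^sup>2 / 2) has_integral q1 $ 3 - q0 $ 3) {q0 $ 2..q1 $ 2}"

lemma lipschitz_on_vec_nth:
  fixes q :: "'b::metric_space \<Rightarrow> real^'n"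
  assumes "L-lipschitz_on S q"
  shows "L-lipschitz_on S (\<lambda>t. q t $ i)"
  using lipschitz_onD[OF assms] lipschitz_on_nonneg[OF assms] dist_vec_nth_le
  by (intro lipschitz_onI) (blast intro: order_trans)+

lemma control_in_cone: "is_control T q u \<Longrightarrow> t \<in> {0..T} \<Longrightarrow> \<bar>u t $ 1\<bar> \<le> u t $ 2"
  unfolding is_control_def U1_def by blast

lemma control_timelike:
  assumes "is_control T q u" "t \<in> {0..T}"
  shows "(u t $ 1)\<^sup>2 \<le> (u t $ 2)\<^sup>2"
  using control_in_cone[OF assms] by (metis abs_ge_zero power2_abs power_mono)

section \<open>From trajectories to profiles\<close>

lemma control_component_derivatives:
  assumes "is_control T q u"
  obtains N where "negligible N"
    "\<And>t. t \<in> {0..T} - N \<Longrightarrow> ((\<lambda>t. q t $ 1) has_real_derivative u t $ 1) (at t within {0..T})"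
    "\<And>t. t \<in> {0..T} - N \<Longrightarrow> ((\<lambda>t. q t $ 2) has_real_derivative u t $ 2) (at t within {0..T})"
    "\<And>t. t \<in> {0..T} - N \<Longrightarrow>
      ((\<lambda>t. q t $ 3) has_real_derivative (q t $ 1)\<^sup>2 / 2 * u t $ 2) (at t within {0..T})"
proof -
  obtain N where N: "negligible N" "\<And>t. t \<in> {0..T} - N \<Longrightarrow>
    (q has_vector_derivative (u t $ 1 *\<^sub>R X1 (q t) + u t $ 2 *\<^sub>R X2 (q t))) (at t within {0..T})"
    using assms unfolding is_control_def by (auto simp: AE_lebesgue_on_iff_negligible)
  have D: "((\<lambda>t. q t $ i) has_real_derivative
      (u t $ 1 *\<^sub>R X1 (q t) + u t $ 2 *\<^sub>R X2 (q t)) $ i) (at t within {0..T})"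
    if "t \<in> {0..T} - N" for t i
    using bounded_linear.has_vector_derivative[OF bounded_linear_vec_nth N(2)[OF that]]
    by (simp add: has_real_derivative_iff_has_vector_derivative)
  show thesis
    using D[of _ 1] D[of _ 2] D[of _ 3]
    by (intro that[OF N(1)]) (simp_all add: X1_def X2_def mult.commute)
qed

lemma control_length_integrand_integrable:
  assumes u: "is_control T q u"
  shows "integrable (lebesgue_on {0..T}) (\<lambda>t. sqrt ((u t $ 2)\<^sup>2 - (u t $ 1)\<^sup>2))"
proof -
  interpret finite_measure "lebesgue_on {0..T}"
    by (rule finite_measure_lebesgue_on) simp
  have [measurable]: "(\<lambda>t. u t $ i) \<in> borel_measurable (lebesgue_on {0..T})" for i
    by (rule borel_measurable_continuous_on[where f = "\<lambda>x. x $ i"])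
      (use u in \<open>auto simp: is_control_def intro!: continuous_intros\<close>)
  obtain B where B: "\<And>t. t \<in> {0..T} \<Longrightarrow> norm (u t) \<le> B"
    using u unfolding is_control_def bounded_iff by blast
  show ?thesis
  proof (rule integrable_const_bound)
    show "AE t in lebesgue_on {0..T}. norm (sqrt ((u t $ 2)\<^sup>2 - (u t $ 1)\<^sup>2)) \<le> B"
    proof (rule AE_I2)
      fix t assume "t \<in> space (lebesgue_on {0..T})"
      then have t: "t \<in> {0..T}" by simp
      have "\<bar>u t $ 2\<bar> \<le> B"
        using component_le_norm_cart[of "u t" 2] B[OF t] by linarith
      moreover have "sqrt ((u t $ 2)\<^sup>2 - (u t $ 1)\<^sup>2) \<le> sqrt ((u t $ 2)\<^sup>2)"
        by (rule real_sqrt_le_mono) simp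
      ultimately show "norm (sqrt ((u t $ 2)\<^sup>2 - (u t $ 1)\<^sup>2)) \<le> B"
        using control_timelike[OF u t] by simp
    qed
  qed measurable
qed

text \<open>
  The first inequality lets \<open>y\<close> serve as a time parameter along the curve; the second compares
  every piece of the curve with its chord.
\<close>

lemma controlled_curve_estimates:
  assumes u: "is_control T q u" and lip: "L-lipschitz_on {0..T} q"
    and st: "0 \<le> s" "s \<le> t" "t \<le> T"
  shows "\<bar>q t $ 1 - q s $ 1\<bar> \<le> q t $ 2 - q s $ 2"
    and "integral {s..t} (\<lambda>r. sqrt ((u r $ 2)\<^sup>2 - (u r $ 1)\<^sup>2))
      \<le> sqrt ((q t $ 2 - q s $ 2)\<^sup>2 - (q t $ 1 - q s $ 1)\<^sup>2)"
proof -
  obtain N where N: "negligible N"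
    "\<And>t. t \<in> {0..T} - N \<Longrightarrow> ((\<lambda>t. q t $ 1) has_real_derivative u t $ 1) (at t within {0..T})"
    "\<And>t. t \<in> {0..T} - N \<Longrightarrow> ((\<lambda>t. q t $ 2) has_real_derivative u t $ 2) (at t within {0..T})"
    "\<And>t. t \<in> {0..T} - N \<Longrightarrow>
      ((\<lambda>t. q t $ 3) has_real_derivative (q t $ 1)\<^sup>2 / 2 * u t $ 2) (at t within {0..T})"
    by (rule control_component_derivatives[OF u]) (rule that)
  have sub: "{s..t} \<subseteq> {0..T}" using st by auto
  have lipc: "L-lipschitz_on {s..t} (\<lambda>t. q t $ i)" for i
    by (rule lipschitz_on_subset[OF _ sub]) (rule lipschitz_on_vec_nth[OF lip])
  have x: "((\<lambda>r. u r $ 1) has_integral q t $ 1 - q s $ 1) {s..t}"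
    by (rule lipschitz_fundamental_theorem_of_calculus[OF lipc st(2) N(1)])
      (use sub in \<open>auto intro!: DERIV_subset[OF N(2)]\<close>)
  have y: "((\<lambda>r. u r $ 2) has_integral q t $ 2 - q s $ 2) {s..t}"
    by (rule lipschitz_fundamental_theorem_of_calculus[OF lipc st(2) N(1)])
      (use sub in \<open>auto intro!: DERIV_subset[OF N(3)]\<close>)
  have "(\<lambda>r. sqrt ((u r $ 2)\<^sup>2 - (u r $ 1)\<^sup>2)) integrable_on {0..T}"
    using control_length_integrand_integrable[OF u] by (rule integrable_on_lebesgue_on) simp
  then have "(\<lambda>r. sqrt ((u r $ 2)\<^sup>2 - (u r $ 1)\<^sup>2)) integrable_on {s..t}"
    using sub by (rule integrable_on_subinterval)
  note I = integrable_integral[OF this]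
  have le: "\<bar>u r $ 1\<bar> \<le> u r $ 2" if "r \<in> {s..t}" for r
    using control_in_cone[OF u] sub that by blast
  show "\<bar>q t $ 1 - q s $ 1\<bar> \<le> q t $ 2 - q s $ 2"
    using has_integral_sqrt_diff_squares_le(1)[OF y x I le] .
  show "integral {s..t} (\<lambda>r. sqrt ((u r $ 2)\<^sup>2 - (u r $ 1)\<^sup>2))
      \<le> sqrt ((q t $ 2 - q s $ 2)\<^sup>2 - (q t $ 1 - q s $ 1)\<^sup>2)"
    using has_integral_sqrt_diff_squares_le(2)[OF y x I le] .
qed

lemma lipschitz_on_integral:
  fixes f :: "real \<Rightarrow> real"
  assumes f: "continuous_on {a..b} f" and ab: "a \<le> b"
  obtains M where "M-lipschitz_on {a..b} (\<lambda>s. integral {a..s} f)"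
proof -
  obtain M where M: "\<And>s. s \<in> {a..b} \<Longrightarrow> norm (f s) \<le> M"
    using compact_imp_bounded[OF compact_continuous_image[OF f compact_Icc]]
    unfolding bounded_iff by blast
  have M0: "0 \<le> M"
    using M[of a] ab norm_ge_zero order_trans by (metis atLeastAtMost_iff order_refl)
  have "M-lipschitz_on {a..b} (\<lambda>s. integral {a..s} f)"
  proof (rule bounded_derivative_imp_lipschitz)
    show "((\<lambda>s. integral {a..s} f) has_derivative (*) (f s)) (at s within {a..b})"
      if "s \<in> {a..b}" for s
      using integral_has_real_derivative[OF f that] by (simp add: has_field_derivative_def)
    show "onorm ((*) (f s)) \<le> M" if "s \<in> {a..b}" for s
      using M[OF that] by (intro onorm_le) (simp add: abs_mult mult_right_mono)
  qed (simp_all add: M0)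
  then show thesis by (rule that)
qed

text \<open>
  Change of variables \<open>s = y t\<close> in which \<open>y\<close> is merely Lipschitz and need not be injective. With
  \<open>H\<close> the primitive of the continuous function \<open>f\<close>, the Lipschitz function \<open>H (y t) - z t\<close> has
  derivative zero almost everywhere, hence is constant.
\<close>

lemma integral_along_lipschitz_curve:
  fixes f y z u :: "real \<Rightarrow> real"
  assumes T: "0 \<le> T" and y: "L-lipschitz_on {0..T} y" and z: "K-lipschitz_on {0..T} z"
    and range: "y ` {0..T} \<subseteq> {a..b}" and f: "continuous_on {a..b} f"
    and N: "negligible N"
    and dy: "\<And>t. t \<in> {0..T} - N \<Longrightarrow> (y has_real_derivative u t) (at t within {0..T})"
    and dz: "\<And>t. t \<in> {0..T} - N \<Longrightarrow> (z has_real_derivative f (y t) * u t) (at t within {0..T})"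
    and ends: "y 0 = a" "y T = b"
  shows "(f has_integral z T - z 0) {a..b}"
proof -
  have ab: "a \<le> b" using range T ends by force
  define H where "H \<eta> = integral {a..\<eta>} f" for \<eta>
  have dH: "(H has_real_derivative f \<eta>) (at \<eta> within {a..b})" if "\<eta> \<in> {a..b}" for \<eta>
    unfolding H_def using f that by (rule integral_has_real_derivative)
  obtain M where "M-lipschitz_on {a..b} H"
    using lipschitz_on_integral[OF f ab] unfolding H_def by blast
  then have "M-lipschitz_on (y ` {0..T}) H"
    using range by (rule lipschitz_on_subset)
  then have "(M * L)-lipschitz_on {0..T} (\<lambda>t. H (y t))"
    using y by (intro lipschitz_on_compose2)
  then have lip: "(M * L + K)-lipschitz_on {0..T} (\<lambda>t. H (y t) - z t)"
    using z by (rule lipschitz_on_diff)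
  have "((\<lambda>t. 0) has_integral (H (y T) - z T) - (H (y 0) - z 0)) {0..T}"
  proof (rule lipschitz_fundamental_theorem_of_calculus[OF lip T N])
    fix t assume t: "t \<in> {0..T} - N"
    then have "y t \<in> {a..b}" using range by blast
    then have "(H has_real_derivative f (y t)) (at (y t) within y ` {0..T})"
      using dH range by (blast intro: DERIV_subset)
    from DERIV_image_chain[OF this dy[OF t]]
    have "((\<lambda>t. H (y t)) has_real_derivative f (y t) * u t) (at t within {0..T})"
      by (simp add: o_def)
    from DERIV_diff[OF this dz[OF t]]
    show "((\<lambda>t. H (y t) - z t) has_real_derivative 0) (at t within {0..T})" by simp
  qed
  then have "H b - z T = H a - z 0"
    using has_integral_unique[OF has_integral_0] ends by fastforce
  then have "H b = z T - z 0" by (simp add: H_def)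
  then show ?thesis
    using integrable_integral[OF integrable_continuous_interval[OF f]] by (simp add: H_def)
qed

text \<open>
  Where \<open>y\<close> stands still, so does \<open>x\<close>, and no length is accumulated there: both the first
  coordinate and the length \<open>\<Lambda>\<close> travelled so far are functions of \<open>y\<close>. The profile is the
  former; evaluating the latter at the vertices of an inscribed polygon writes the length of the
  trajectory as a sum of terms bounded by the chords.
\<close>

lemma trajectory_imp_profile:
  assumes c: "connects T q q0 q1"
  obtains f where "q0 $ 2 \<le> q1 $ 2" "profile q0 q1 f"
    "\<And>n. 0 < n \<Longrightarrow> traj_length T q \<le> chord_sum n f (q0 $ 2) (q1 $ 2)"
proof -
  let ?a = "q0 $ 2" and ?b = "q1 $ 2"
  obtain L u where T: "0 \<le> T" and lip: "L-lipschitz_on {0..T} q" and u: "is_control T q u"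
    and ends: "q 0 = q0" "q T = q1"
    using c by (auto simp: connects_def admissible_trajectory_def)
  let ?len = "\<lambda>r. sqrt ((u r $ 2)\<^sup>2 - (u r $ 1)\<^sup>2)"
  note int_len = control_length_integrand_integrable[OF u]
  define \<Lambda> where "\<Lambda> t = integral {0..t} ?len" for t
  note est = controlled_curve_estimates[OF u lip]
  have lipc: "L-lipschitz_on {0..T} (\<lambda>t. q t $ i)" for i
    by (rule lipschitz_on_vec_nth[OF lip])
  have ab: "?a \<le> ?b" using est(1)[of 0 T] T ends by auto
  have range: "q t $ 2 \<in> {?a..?b}" if "t \<in> {0..T}" for t
    using est(1)[of 0 t] est(1)[of t T] that ends by auto
  have \<Lambda>: "\<Lambda> t - \<Lambda> s = integral {s..t} ?len" if "0 \<le> s" "s \<le> t" "t \<le> T" for s t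
  proof -
    have "?len integrable_on {0..T}"
      using int_len by (rule integrable_on_lebesgue_on) simp
    then have "?len integrable_on {0..t}"
      using that by (auto intro: integrable_on_subinterval)
    from Henstock_Kurzweil_Integration.integral_combine[OF that(1,2) this]
    show ?thesis by (simp add: \<Lambda>_def)
  qed
  \<comment> \<open>The times \<open>s\<close> and \<open>t\<close> are compared through \<open>y\<close>, so \<open>t < s\<close> may occur; then \<open>y\<close> is constant in between.\<close>
  have key: "\<bar>q t $ 1 - q s $ 1\<bar> \<le> q t $ 2 - q s $ 2 \<and>
      \<Lambda> t - \<Lambda> s \<le> sqrt ((q t $ 2 - q s $ 2)\<^sup>2 - (q t $ 1 - q s $ 1)\<^sup>2)"
    if "s \<in> {0..T}" "t \<in> {0..T}" "q s $ 2 \<le> q t $ 2" for s t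
  proof (cases "s \<le> t")
    case True
    then show ?thesis using est[of s t] \<Lambda>[of s t] that by auto
  next
    case False
    then have x: "\<bar>q s $ 1 - q t $ 1\<bar> \<le> q s $ 2 - q t $ 2"
      using est(1)[of t s] that by auto
    have "0 \<le> integral {t..s} ?len"
      using control_timelike[OF u] that False
      by (intro integral_nonneg integrable_on_subinterval[OF integrable_on_lebesgue_on[OF int_len]]) auto
    then have "\<Lambda> t - \<Lambda> s \<le> 0" using \<Lambda>[of t s] that False by auto
    moreover have "q s $ 2 = q t $ 2" "q s $ 1 = q t $ 1" using x that(3) by auto
    ultimately show ?thesis by simp
  qed
  define \<tau> where "\<tau> \<eta> = (SOME t. t \<in> {0..T} \<and> q t $ 2 = \<eta>)" for \<eta>
  have \<tau>: "\<tau> \<eta> \<in> {0..T}" "q (\<tau> \<eta>) $ 2 = \<eta>" if "\<eta> \<in> {?a..?b}" for \<eta>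
  proof -
    have "\<exists>t\<ge>0. t \<le> T \<and> q t $ 2 = \<eta>"
      using that ends T lipschitz_on_continuous_on[OF lipc] by (intro IVT') auto
    then have "\<exists>t. t \<in> {0..T} \<and> q t $ 2 = \<eta>" by auto
    from someI_ex[OF this] show "\<tau> \<eta> \<in> {0..T}" "q (\<tau> \<eta>) $ 2 = \<eta>"
      by (auto simp: \<tau>_def)
  qed
  define f where "f \<eta> = q (\<tau> \<eta>) $ 1" for \<eta>
  have f: "f (q t $ 2) = q t $ 1" if "t \<in> {0..T}" for t
    using key[of "\<tau> (q t $ 2)" t] \<tau>[OF range[OF that]] that by (simp add: f_def)
  have "1-lipschitz_on {?a..?b} f"
  proof (rule lipschitz_on_leI)
    fix \<eta> \<theta> assume "\<eta> \<in> {?a..?b}" "\<theta> \<in> {?a..?b}" "\<eta> \<le> \<theta>"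
    then show "dist (f \<eta>) (f \<theta>) \<le> 1 * dist \<eta> \<theta>"
      using key[of "\<tau> \<eta>" "\<tau> \<theta>"] \<tau>[of \<eta>] \<tau>[of \<theta>]
      by (simp add: f_def dist_real_def abs_minus_commute)
  qed simp
  moreover have f_ends: "f ?a = q0 $ 1" "f ?b = q1 $ 1"
    using f[of 0] f[of T] T unfolding ends by simp_all
  moreover have "((\<lambda>s. (f s)\<^sup>2 / 2) has_integral q1 $ 3 - q0 $ 3) {?a..?b}"
  proof -
    obtain N where N: "negligible N"
      "\<And>t. t \<in> {0..T} - N \<Longrightarrow> ((\<lambda>t. q t $ 1) has_real_derivative u t $ 1) (at t within {0..T})"
      "\<And>t. t \<in> {0..T} - N \<Longrightarrow> ((\<lambda>t. q t $ 2) has_real_derivative u t $ 2) (at t within {0..T})"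
      "\<And>t. t \<in> {0..T} - N \<Longrightarrow>
        ((\<lambda>t. q t $ 3) has_real_derivative (q t $ 1)\<^sup>2 / 2 * u t $ 2) (at t within {0..T})"
      by (rule control_component_derivatives[OF u]) (rule that)
    have "((\<lambda>s. (f s)\<^sup>2 / 2) has_integral q T $ 3 - q 0 $ 3) {?a..?b}"
    proof (rule integral_along_lipschitz_curve[OF T lipc[of 2] lipc[of 3] _ _ N(1,3)])
      show "(\<lambda>t. q t $ 2) ` {0..T} \<subseteq> {?a..?b}" by (intro image_subsetI range)
      show "((\<lambda>t. q t $ 3) has_real_derivative (f (q t $ 2))\<^sup>2 / 2 * u t $ 2) (at t within {0..T})"
        if "t \<in> {0..T} - N" for t
        using N(4)[OF that] f[of t] that by simp
      show "continuous_on {?a..?b} (\<lambda>s. (f s)\<^sup>2 / 2)"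
        by (intro continuous_intros lipschitz_on_continuous_on[OF \<open>1-lipschitz_on {?a..?b} f\<close>]) simp
    qed (simp_all only: ends)
    then show ?thesis by (simp add: ends)
  qed
  ultimately have prof: "profile q0 q1 f"
    by (simp add: profile_def)
  have len: "traj_length T q \<le> chord_sum n f ?a ?b" if n: "0 < n" for n
  proof -
    define h where "h = (?b - ?a) / n"
    have h: "0 \<le> h" "n * h = ?b - ?a" using n ab by (auto simp: h_def)
    define p where "p k = ?a + real k * h" for k
    have p: "p k \<in> {?a..?b}" if "k \<le> n" for k
      using h mult_right_mono[of "real k" "real n" h] that by (auto simp: p_def)
    have "traj_length T q = \<Lambda> T - \<Lambda> 0"
      using traj_length_eq[OF u] lebesgue_integral_eq_integral[OF int_len]
      by (simp add: control_length_def \<Lambda>_def)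
    also have "\<dots> \<le> \<Lambda> (\<tau> (p n)) - \<Lambda> (\<tau> (p 0))"
    proof -
      have "p n = ?b" "p 0 = ?a" using h by (simp_all add: p_def)
      then have "\<tau> (p n) \<in> {0..T}" "q (\<tau> (p n)) $ 2 = ?b" "\<tau> (p 0) \<in> {0..T}" "q (\<tau> (p 0)) $ 2 = ?a"
        and "q (\<tau> (p n)) $ 1 = q1 $ 1" "q (\<tau> (p 0)) $ 1 = q0 $ 1"
        using \<tau>[of ?a] \<tau>[of ?b] ab f_ends by (simp_all add: f_def)
      then show ?thesis
        using key[of "\<tau> (p n)" T] key[of 0 "\<tau> (p 0)"] T unfolding ends by simp
    qed
    also have "\<dots> = (\<Sum>k<n. \<Lambda> (\<tau> (p (Suc k))) - \<Lambda> (\<tau> (p k)))"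
      by (rule sum_lessThan_telescope[symmetric])
    also have "\<dots> \<le> (\<Sum>k<n. sqrt (h\<^sup>2 - (f (p (Suc k)) - f (p k))\<^sup>2))"
    proof (rule sum_mono)
      fix k assume "k \<in> {..<n}"
      then have "p k \<in> {?a..?b}" "p (Suc k) \<in> {?a..?b}"
        by (intro p; simp)+
      moreover have "p (Suc k) - p k = h" "p k \<le> p (Suc k)"
        using h(1) by (simp_all add: p_def algebra_simps)
      ultimately show "\<Lambda> (\<tau> (p (Suc k))) - \<Lambda> (\<tau> (p k)) \<le> sqrt (h\<^sup>2 - (f (p (Suc k)) - f (p k))\<^sup>2)"
        using key[of "\<tau> (p k)" "\<tau> (p (Suc k))"] \<tau>[of "p k"] \<tau>[of "p (Suc k)"]
        by (simp add: f_def)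
    qed
    also have "\<dots> = chord_sum n f ?a ?b"
      by (simp add: chord_sum_def p_def h_def)
    finally show ?thesis .
  qed
  show thesis by (rule that[OF ab prof len])
qed

section \<open>From profiles to trajectories\<close>

lemma straddling_difference_quotient_tendsto:
  fixes F :: "real \<Rightarrow> real"
  assumes D: "(F has_real_derivative d) (at x)"
    and p: "\<And>n. p n \<le> x" "\<And>n. x \<le> p n + h n" and h: "\<And>n. 0 < h n" "h \<longlonglongrightarrow> 0"
  shows "(\<lambda>n. (F (p n + h n) - F (p n)) / h n) \<longlonglongrightarrow> d"
proof (rule tendstoI)
  fix e :: real assume e: "0 < e"
  obtain \<delta> where \<delta>: "0 < \<delta>"
    "\<And>y. norm (y - x) < \<delta> \<Longrightarrow> norm (F y - F x - d * (y - x)) \<le> e / 2 * norm (y - x)"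
    using D e half_gt_zero[OF e] unfolding has_field_derivative_def has_derivative_at_alt by blast
  have "\<forall>\<^sub>F n in sequentially. h n < \<delta>"
    using h(2) \<delta>(1) by (rule order_tendstoD)
  then show "\<forall>\<^sub>F n in sequentially. dist ((F (p n + h n) - F (p n)) / h n) d < e"
  proof eventually_elim
    case (elim n)
    let ?v = "p n + h n" and ?w = "p n"
    have "\<bar>F ?v - F x - d * (?v - x)\<bar> \<le> e / 2 * (?v - x)"
      using \<delta>(2)[of ?v] p[of n] elim by simp
    moreover have "\<bar>F ?w - F x - d * (?w - x)\<bar> \<le> e / 2 * (x - ?w)"
      using \<delta>(2)[of ?w] p[of n] elim by simp
    moreover have "F ?v - F ?w - d * h n = (F ?v - F x - d * (?v - x)) - (F ?w - F x - d * (?w - x))"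
      and "e / 2 * h n = e / 2 * (?v - x) + e / 2 * (x - ?w)"
      by (simp_all add: algebra_simps flip: add_divide_distrib)
    ultimately have "\<bar>F ?v - F ?w - d * h n\<bar> \<le> e / 2 * h n"
      by linarith
    also have "\<dots> < e * h n" using e h(1)[of n] by simp
    finally have "\<bar>F ?v - F ?w - d * h n\<bar> / h n < e"
      using h(1)[of n] by (simp add: divide_simps)
    moreover have "(F ?v - F ?w) / h n - d = (F ?v - F ?w - d * h n) / h n"
      using h(1)[of n] by (simp add: diff_divide_distrib)
    then have "dist ((F ?v - F ?w) / h n) d = \<bar>F ?v - F ?w - d * h n\<bar> / h n"
      using h(1)[of n] by (simp add: dist_real_def abs_divide)
    ultimately show ?case by simp
  qed
qed

lemma has_integral_step_function:
  fixes c :: "nat \<Rightarrow> real"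
  assumes h: "0 < h"
  shows "((\<lambda>t. c (nat \<lfloor>t / h\<rfloor>)) has_integral (\<Sum>k<n. h * c k)) {0..real n * h}"
proof (induction n)
  case 0
  show ?case using has_integral_refl(2)[of _ "0::real"] by simp
next
  case (Suc n)
  let ?l = "real n * h" and ?r = "real (Suc n) * h"
  have "((\<lambda>t. c n) has_integral (?r - ?l) * c n) {?l..?r}"
    using has_integral_const_real[of "c n" ?l ?r] h by (simp add: mult_right_mono)
  then have "((\<lambda>t. c n) has_integral h * c n) {?l..?r}"
    by (simp add: algebra_simps)
  then have "((\<lambda>t. c (nat \<lfloor>t / h\<rfloor>)) has_integral h * c n) {?l..?r}"
  proof (rule has_integral_spike[OF negligible_sing[of ?r], rotated])
    fix t assume t: "t \<in> {?l..?r} - {?r}"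
    then have "\<lfloor>t / h\<rfloor> = int n"
      using h by (intro floor_unique) (auto simp: divide_simps add.commute)
    then show "c (nat \<lfloor>t / h\<rfloor>) = c n" by simp
  qed
  from has_integral_combine[OF _ _ Suc.IH this]
  show ?case using h by (simp add: mult_right_mono)
qed

lemma chord_sum_cong:
  assumes "\<And>s. s \<in> {a..b} \<Longrightarrow> f s = F s" and "a \<le> b"
  shows "chord_sum n f a b = chord_sum n F a b"
proof (cases "n = 0")
  case False
  define h where "h = (b - a) / n"
  have h: "0 \<le> h" "n * h = b - a" using False assms(2) by (auto simp: h_def)
  have eq: "f (a + real k * h) = F (a + real k * h)" if "k \<le> n" for k
    using h mult_right_mono[of "real k" "real n" h] that by (intro assms(1)) auto
  show ?thesis
    unfolding chord_sum_def h_def[symmetric]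
  proof (rule sum.cong)
    fix k assume "k \<in> {..<n}"
    then show "sqrt (h\<^sup>2 - (f (a + real (Suc k) * h) - f (a + real k * h))\<^sup>2)
        = sqrt (h\<^sup>2 - (F (a + real (Suc k) * h) - F (a + real k * h))\<^sup>2)"
      using eq[of k] eq[of "Suc k"] by simp
  qed simp
qed (simp add: chord_sum_def)

text \<open>
  The inscribed polygon on \<open>n\<close> subintervals has piecewise constant slope, and at each point of
  differentiability this slope is a difference quotient over a shrinking interval around the point.
  Hence the integrands converge almost everywhere, and they are bounded by 1.
\<close>

lemma chord_sum_tendsto_integral:
  fixes F g :: "real \<Rightarrow> real"
  assumes F: "1-lipschitz_on UNIV F" and ab: "a \<le> b"
    and g[measurable]: "g \<in> borel_measurable borel" and M: "negligible M"
    and D: "\<And>x. x \<notin> M \<Longrightarrow> (F has_real_derivative g x) (at x)"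
  shows "(\<lambda>n. chord_sum (Suc n) F a b) \<longlonglongrightarrow>
    (LINT t|lebesgue_on {0..b - a}. sqrt (1 - (g (a + t))\<^sup>2))"
proof (cases "a = b")
  case True
  have "(LINT t|lebesgue_on {0..b - a}. sqrt (1 - (g (a + t))\<^sup>2)) = 0"
    by (rule integral_eq_zero_AE)
      (auto simp: True AE_lebesgue_on_iff_negligible intro!: exI[of _ "{0}"])
  then show ?thesis by (simp add: chord_sum_def True)
next
  case False
  define h where "h n = (b - a) / real (Suc n)" for n
  have h: "0 < h n" for n using ab False by (simp add: h_def)
  have h0: "h \<longlonglongrightarrow> 0"
    unfolding h_def by (rule LIMSEQ_Suc[OF lim_const_over_n])
  \<comment> \<open>The integrand of the \<open>n\<close>-th polygon on its \<open>k\<close>-th subinterval.\<close>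
  define c where "c n k = sqrt (1 - ((F (a + real k * h n + h n) - F (a + real k * h n)) / h n)\<^sup>2)" for n k
  have slope: "((F (x + h n) - F x) / h n)\<^sup>2 \<le> 1" for x n
    using lipschitz_on_normD[OF F, of "x + h n" x] h[of n]
    by (simp add: abs_square_le_1 abs_divide)
  have lim: "(\<lambda>n. LINT t|lebesgue_on {0..b - a}. c n (nat \<lfloor>t / h n\<rfloor>)) \<longlonglongrightarrow>
      (LINT t|lebesgue_on {0..b - a}. sqrt (1 - (g (a + t))\<^sup>2))"
    and int: "integrable (lebesgue_on {0..b - a}) (\<lambda>t. c n (nat \<lfloor>t / h n\<rfloor>))" for n
  proof -
    have 1: "(\<lambda>t. sqrt (1 - (g (a + t))\<^sup>2)) \<in> borel_measurable (lebesgue_on {0..b - a})"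
      by (intro measurable_restrict_space1 measurable_completion) simp
    have 2: "(\<lambda>t. c n (nat \<lfloor>t / h n\<rfloor>)) \<in> borel_measurable (lebesgue_on {0..b - a})" for n
      by (intro measurable_restrict_space1 measurable_completion) simp
    have 3: "integrable (lebesgue_on {0..b - a}) (\<lambda>t. 1 :: real)"
      by simp
    have 4: "AE t in lebesgue_on {0..b - a}. norm (c n (nat \<lfloor>t / h n\<rfloor>)) \<le> 1" for n
      using slope by (intro AE_I2) (auto simp: c_def)
    have 5: "AE t in lebesgue_on {0..b - a}. (\<lambda>n. c n (nat \<lfloor>t / h n\<rfloor>)) \<longlonglongrightarrow> sqrt (1 - (g (a + t))\<^sup>2)"
    proof -
      have "(\<lambda>n. c n (nat \<lfloor>t / h n\<rfloor>)) \<longlonglongrightarrow> sqrt (1 - (g (a + t))\<^sup>2)"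
        if t: "t \<in> {0..b - a} - (+) (- a) ` M" for t
      proof -
        have "a + t \<notin> M" using t by (force simp: image_iff)
        note d = D[OF this]
        have floor: "real (nat \<lfloor>t / h n\<rfloor>) * h n \<le> t" "t \<le> real (nat \<lfloor>t / h n\<rfloor>) * h n + h n" for n
          using h[of n] t floor_correct[of "t / h n"]
          by (auto simp: divide_simps algebra_simps)
        have "(\<lambda>n. (F (a + real (nat \<lfloor>t / h n\<rfloor>) * h n + h n) - F (a + real (nat \<lfloor>t / h n\<rfloor>) * h n)) / h n)
            \<longlonglongrightarrow> g (a + t)"
          by (rule straddling_difference_quotient_tendsto[OF d _ _ h h0])
            (use floor in \<open>auto simp: add.assoc\<close>)
        then show ?thesis unfolding c_def by (intro tendsto_intros)
      qed
      then show ?thesis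
        using negligible_translation[OF M, of "- a"] by (auto simp: AE_lebesgue_on_iff_negligible)
    qed
    show "(\<lambda>n. LINT t|lebesgue_on {0..b - a}. c n (nat \<lfloor>t / h n\<rfloor>)) \<longlonglongrightarrow>
      (LINT t|lebesgue_on {0..b - a}. sqrt (1 - (g (a + t))\<^sup>2))"
      by (rule integral_dominated_convergence[OF 1 2 3 5 4])
    show "integrable (lebesgue_on {0..b - a}) (\<lambda>t. c n (nat \<lfloor>t / h n\<rfloor>))"
      by (rule integrable_dominated_convergence2[OF 1 2 3 5 4])
  qed
  have "(LINT t|lebesgue_on {0..b - a}. c n (nat \<lfloor>t / h n\<rfloor>)) = chord_sum (Suc n) F a b" for n
  proof -
    have "(LINT t|lebesgue_on {0..b - a}. c n (nat \<lfloor>t / h n\<rfloor>))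
        = integral {0..real (Suc n) * h n} (\<lambda>t. c n (nat \<lfloor>t / h n\<rfloor>))"
      using lebesgue_integral_eq_integral[OF int] by (simp add: h_def)
    also have "\<dots> = (\<Sum>k<Suc n. h n * c n k)"
      by (rule integral_unique[OF has_integral_step_function[OF h]])
    also have "\<dots> = chord_sum (Suc n) F a b"
      unfolding chord_sum_def h_def[symmetric]
    proof (rule sum.cong)
      fix k
      let ?d = "F (a + real k * h n + h n) - F (a + real k * h n)"
      have "h n * c n k = sqrt ((h n)\<^sup>2 * (1 - (?d / h n)\<^sup>2))"
        using h[of n] by (simp add: c_def real_sqrt_mult)
      also have "(h n)\<^sup>2 * (1 - (?d / h n)\<^sup>2) = (h n)\<^sup>2 - ?d\<^sup>2"
        using h[of n] by (simp add: power_divide right_diff_distrib)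
      also have "a + real k * h n + h n = a + real (Suc k) * h n"
        by (simp add: algebra_simps)
      finally show "h n * c n k = sqrt ((h n)\<^sup>2 - (F (a + real (Suc k) * h n) - F (a + real k * h n))\<^sup>2)" .
    qed simp
    finally show ?thesis .
  qed
  with lim show ?thesis by simp
qed

lemma has_vector_derivative_vec_nthI:
  fixes q :: "real \<Rightarrow> real^'n"
  assumes "\<And>i. ((\<lambda>t. q t $ i) has_real_derivative d $ i) (at t within S)"
  shows "(q has_vector_derivative d) (at t within S)"
  unfolding has_vector_derivative_def
  by (subst has_derivative_componentwise_within)
    (use assms in \<open>auto simp: Basis_vec_def inner_axis has_field_derivative_def mult.commute[of _ "d $ _"]\<close>)

lemma lipschitz_on_vec_nthI:
  fixes q :: "'b::metric_space \<Rightarrow> real^'n"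
  assumes "\<And>i. (L i)-lipschitz_on S (\<lambda>t. q t $ i)"
  shows "(\<Sum>i\<in>UNIV. L i)-lipschitz_on S q"
proof (rule lipschitz_onI)
  fix s t assume "s \<in> S" "t \<in> S"
  have "dist (q s) (q t) \<le> (\<Sum>i\<in>UNIV. \<bar>(q s - q t) $ i\<bar>)"
    unfolding dist_norm by (rule norm_le_l1_cart)
  also have "\<dots> \<le> (\<Sum>i\<in>UNIV. L i * dist s t)"
    using lipschitz_onD[OF assms \<open>s \<in> S\<close> \<open>t \<in> S\<close>] by (intro sum_mono) (simp add: dist_real_def)
  finally show "dist (q s) (q t) \<le> (\<Sum>i\<in>UNIV. L i) * dist s t"
    by (simp add: sum_distrib_right)
qed (intro sum_nonneg lipschitz_on_nonneg[OF assms])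

text \<open>
  The curve over the profile, parametrised by \<open>t = y - q0 $ 2\<close>, is driven by the control
  \<open>(f', 1)\<close>. Its length is the limit of the lengths of the inscribed polygons, so the bounds of all
  trajectories by polygons are sharp for these curves.
\<close>

lemma profile_imp_trajectory:
  assumes ab: "q0 $ 2 \<le> q1 $ 2" and f: "profile q0 q1 f"
  obtains q where "connects (q1 $ 2 - q0 $ 2) q q0 q1"
    "(\<lambda>n. chord_sum (Suc n) f (q0 $ 2) (q1 $ 2)) \<longlonglongrightarrow> traj_length (q1 $ 2 - q0 $ 2) q"
proof -
  define a b T where "a = q0 $ 2" "b = q1 $ 2" "T = b - a"
  have T: "0 \<le> T" and ab: "a \<le> b" using ab by (auto simp: a_b_T_def)
  have lip: "1-lipschitz_on {a..b} f" and ends: "f a = q0 $ 1" "f b = q1 $ 1"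
    and vol: "((\<lambda>s. (f s)\<^sup>2 / 2) has_integral q1 $ 3 - q0 $ 3) {a..b}"
    using f by (auto simp: profile_def a_b_T_def)
  let ?F = "\<lambda>x. f (max a (min b x))"
  obtain g M where g: "g \<in> borel_measurable borel" "\<And>x. \<bar>g x\<bar> \<le> 1" "negligible M"
    "\<And>x. x \<notin> M \<Longrightarrow> (?F has_real_derivative g x) (at x)"
    by (rule lipschitz_real_AE_derivative[OF lipschitz_on_clamp[OF lip ab]]) blast
  have cont: "continuous_on {a..b} (\<lambda>s. (f s)\<^sup>2 / 2)"
    by (intro continuous_intros lipschitz_on_continuous_on[OF lip]) simp
  define Z where "Z s = integral {a..s} (\<lambda>s. (f s)\<^sup>2 / 2)" for s
  obtain K where K: "K-lipschitz_on {a..b} Z"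
    using lipschitz_on_integral[OF cont ab] unfolding Z_def by blast
  define q :: "real \<Rightarrow> real^3" where "q t = vector [f (a + t), a + t, q0 $ 3 + Z (a + t)]" for t
  define u :: "real \<Rightarrow> real^2" where "u t = vector [g (a + t), 1]" for t
  have sh: "1-lipschitz_on {0..T} (\<lambda>t. a + t)"
    by (rule lipschitz_onI) (auto simp: dist_real_def)
  have im: "(\<lambda>t. a + t) ` {0..T} = {a..b}"
    by (simp add: a_b_T_def)
  have "\<exists>L. L-lipschitz_on {0..T} q"
  proof -
    have "(1 * 1)-lipschitz_on {0..T} (\<lambda>t. f (a + t))"
      by (rule lipschitz_on_compose2[OF sh]) (simp only: im lip)
    moreover have "(K * 1)-lipschitz_on {0..T} (\<lambda>t. Z (a + t))"
      by (rule lipschitz_on_compose2[OF sh]) (simp only: im K)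
    then have "(0 + K * 1)-lipschitz_on {0..T} (\<lambda>t. q0 $ 3 + Z (a + t))"
      by (intro lipschitz_on_add lipschitz_on_constant)
    ultimately have "\<forall>i. \<exists>L. L-lipschitz_on {0..T} (\<lambda>t. q t $ i)"
      using sh unfolding forall_3 q_def vector_3 by blast
    then obtain L where "\<And>i. (L i)-lipschitz_on {0..T} (\<lambda>t. q t $ i)" by metis
    then show ?thesis using lipschitz_on_vec_nthI by blast
  qed
  have "is_control T q u"
    unfolding is_control_def
  proof (intro conjI)
    have "u = (\<lambda>t. g (a + t) *\<^sub>R axis 1 1 + axis 2 1)"
      by (auto simp: u_def vec_eq_iff forall_2 axis_def)
    then show "u \<in> borel_measurable (lebesgue_on {0..T})"
      using g(1) by (intro measurable_restrict_space1 measurable_completion) simp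
    show "bounded (u ` {0..T})"
      unfolding bounded_iff
    proof (intro exI[of _ 2] ballI)
      fix v assume "v \<in> u ` {0..T}"
      then obtain t where "v = u t" by blast
      then show "norm v \<le> 2"
        using norm_le_l1_cart[of v] g(2)[of "a + t"] by (simp add: u_def sum_2)
    qed
    show "u ` {0..T} \<subseteq> U1" using g(2) by (auto simp: U1_def u_def)
    have "(q has_vector_derivative u t $ 1 *\<^sub>R X1 (q t) + u t $ 2 *\<^sub>R X2 (q t)) (at t within {0..T})"
      if t: "t \<in> {0..T} - (+) (- a) ` M" for t
    proof (rule has_vector_derivative_vec_nthI)
      fix i
      have "a + t \<notin> M" "a + t \<in> {a..b}" using t im by (force simp: image_iff)+
      have shift: "((\<lambda>t. a + t) has_real_derivative 1) (at t within {0..T})"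
        by (auto intro!: derivative_eq_intros)
      have "(f has_real_derivative g (a + t)) (at (a + t) within (\<lambda>t. a + t) ` {0..T})"
        unfolding im using g(4) \<open>a + t \<notin> M\<close> \<open>a + t \<in> {a..b}\<close> by (intro has_real_derivative_clamp) auto
      from DERIV_image_chain[OF this shift]
      have 1: "((\<lambda>t. f (a + t)) has_real_derivative g (a + t)) (at t within {0..T})"
        by (simp add: o_def)
      have "(Z has_real_derivative (f (a + t))\<^sup>2 / 2) (at (a + t) within (\<lambda>t. a + t) ` {0..T})"
        unfolding im Z_def by (rule integral_has_real_derivative[OF cont \<open>a + t \<in> {a..b}\<close>])
      from DERIV_add[OF DERIV_const DERIV_image_chain[OF this shift]]
      have 3: "((\<lambda>t. q0 $ 3 + Z (a + t)) has_real_derivative (f (a + t))\<^sup>2 / 2) (at t within {0..T})"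
        by (simp add: o_def)
      have "\<forall>i. ((\<lambda>t. q t $ i) has_real_derivative
          (u t $ 1 *\<^sub>R X1 (q t) + u t $ 2 *\<^sub>R X2 (q t)) $ i) (at t within {0..T})"
        unfolding forall_3 using 1 shift 3 by (simp add: q_def u_def X1_def X2_def)
      then show "((\<lambda>t. q t $ i) has_real_derivative
          (u t $ 1 *\<^sub>R X1 (q t) + u t $ 2 *\<^sub>R X2 (q t)) $ i) (at t within {0..T})" by blast
    qed
    then show "AE t in lebesgue_on {0..T}.
        (q has_vector_derivative u t $ 1 *\<^sub>R X1 (q t) + u t $ 2 *\<^sub>R X2 (q t)) (at t within {0..T})"
      using negligible_translation[OF g(3), of "- a"] by (auto simp: AE_lebesgue_on_iff_negligible)
  qed
  note u = this
  show thesis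
  proof
    have "Z a = 0" "Z b = q1 $ 3 - q0 $ 3"
      using integral_unique[OF vol] by (simp_all add: Z_def)
    then have "q 0 = q0" "q T = q1"
      using ends by (auto simp: q_def vec_eq_iff forall_3 a_b_T_def)
    then show "connects (q1 $ 2 - q0 $ 2) q q0 q1"
      using T u \<open>\<exists>L. L-lipschitz_on {0..T} q\<close>
      unfolding connects_def admissible_trajectory_def a_b_T_def by blast
    have "(\<lambda>n. chord_sum (Suc n) ?F a b) \<longlonglongrightarrow>
        (LINT t|lebesgue_on {0..b - a}. sqrt (1 - (g (a + t))\<^sup>2))"
      by (rule chord_sum_tendsto_integral[OF lipschitz_on_clamp[OF lip ab] ab g(1,3,4)])
    moreover have "chord_sum n f a b = chord_sum n ?F a b" for n
      using ab by (intro chord_sum_cong) auto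
    moreover have "traj_length T q = (LINT t|lebesgue_on {0..b - a}. sqrt (1 - (g (a + t))\<^sup>2))"
      unfolding traj_length_eq[OF u] control_length_def by (simp add: u_def a_b_T_def)
    ultimately show "(\<lambda>n. chord_sum (Suc n) f (q0 $ 2) (q1 $ 2)) \<longlonglongrightarrow> traj_length (q1 $ 2 - q0 $ 2) q"
      by (simp add: a_b_T_def)
  qed
qed

section \<open>Existence of a longest trajectory\<close>

text \<open>
  Profiles are equicontinuous and start at the same value, so the Arzela--Ascoli theorem applies. The
  Lipschitz bound, the end values and the integral constraint all pass to a uniform limit, because
  none of them involves the derivative.
\<close>

lemma profiles_sequentially_compact:
  assumes ab: "q0 $ 2 \<le> q1 $ 2" and f: "\<And>n. profile q0 q1 (f n)"
  obtains g r where "profile q0 q1 g" "strict_mono (r :: nat \<Rightarrow> nat)"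
    "\<And>s. s \<in> {q0 $ 2..q1 $ 2} \<Longrightarrow> (\<lambda>n. f (r n) s) \<longlonglongrightarrow> g s"
proof -
  let ?I = "{q0 $ 2..q1 $ 2}"
  define B where "B = \<bar>q0 $ 1\<bar> + (q1 $ 2 - q0 $ 2)"
  have lip: "dist (f n s) (f n t) \<le> dist s t" if "s \<in> ?I" "t \<in> ?I" for n s t
    using f[of n] lipschitz_onD[of 1 ?I "f n" s t] that by (simp add: profile_def)
  have bound: "\<bar>f n s\<bar> \<le> B" if "s \<in> ?I" for n s
  proof -
    have "\<bar>f n s - q0 $ 1\<bar> \<le> s - q0 $ 2"
      using lip[of s "q0 $ 2" n] f[of n] that ab by (simp add: profile_def dist_real_def)
    then show ?thesis using that unfolding B_def atLeastAtMost_iff by linarith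
  qed
  obtain g r where r: "strict_mono (r :: nat \<Rightarrow> nat)"
    and unif: "\<And>e. 0 < e \<Longrightarrow> \<exists>N. \<forall>n s. n \<ge> N \<and> s \<in> ?I \<longrightarrow> norm (f (r n) s - g s) < e"
  proof (rule Arzela_Ascoli[of ?I f B])
    show "\<exists>d>0. \<forall>n t. t \<in> ?I \<and> norm (s - t) < d \<longrightarrow> norm (f n s - f n t) < e"
      if "s \<in> ?I" "0 < e" for s e
      using lip[OF that(1)] that(2) unfolding dist_norm
      by (intro exI[of _ e]) (blast intro: le_less_trans)
  qed (use bound in auto)
  have lim: "(\<lambda>n. f (r n) s) \<longlonglongrightarrow> g s" if "s \<in> ?I" for s
    unfolding LIMSEQ_iff using unif that by meson
  have "1-lipschitz_on ?I g"
  proof (rule lipschitz_onI)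
    fix s t assume st: "s \<in> ?I" "t \<in> ?I"
    show "dist (g s) (g t) \<le> 1 * dist s t"
      using lip[OF st] by (intro tendsto_upperbound[OF tendsto_dist[OF lim[OF st(1)] lim[OF st(2)]]]) auto
  qed simp
  moreover have "g (q0 $ 2) = q0 $ 1" "g (q1 $ 2) = q1 $ 1"
    using lim[of "q0 $ 2"] lim[of "q1 $ 2"] f ab
    by (auto simp: profile_def LIMSEQ_const_iff)
  moreover have "((\<lambda>s. (g s)\<^sup>2 / 2) has_integral q1 $ 3 - q0 $ 3) ?I"
  proof -
    have int: "((\<lambda>s. (f (r n) s)\<^sup>2 / 2) has_integral q1 $ 3 - q0 $ 3) ?I" for n
      using f by (simp add: profile_def)
    have 1: "(\<lambda>s. (f (r n) s)\<^sup>2 / 2) integrable_on ?I" for n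
      using int by blast
    have 2: "(\<lambda>s. B\<^sup>2 / 2) integrable_on ?I"
      by (rule integrable_const_ivl)
    have 3: "norm ((f (r n) s)\<^sup>2 / 2) \<le> B\<^sup>2 / 2" if "s \<in> ?I" for n s
      using power_mono[OF bound[OF that, of "r n"] abs_ge_zero, of 2] by simp
    have 4: "(\<lambda>n. (f (r n) s)\<^sup>2 / 2) \<longlonglongrightarrow> (g s)\<^sup>2 / 2" if "s \<in> ?I" for s
      by (intro tendsto_intros lim that) simp
    have "(\<lambda>n. integral ?I (\<lambda>s. (f (r n) s)\<^sup>2 / 2)) \<longlonglongrightarrow> integral ?I (\<lambda>s. (g s)\<^sup>2 / 2)"
      using 1 2 3 4 by (rule dominated_convergence(2))
    then have "integral ?I (\<lambda>s. (g s)\<^sup>2 / 2) = q1 $ 3 - q0 $ 3"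
      unfolding integral_unique[OF int] LIMSEQ_const_iff by (rule sym)
    moreover have "(\<lambda>s. (g s)\<^sup>2 / 2) integrable_on ?I"
      using 1 2 3 4 by (rule dominated_convergence(1))
    ultimately show ?thesis
      unfolding has_integral_integrable_integral by blast
  qed
  ultimately have "profile q0 q1 g" by (simp add: profile_def)
  then show thesis using r lim by (rule that)
qed

lemma tendsto_chord_sum:
  assumes f: "\<And>s. s \<in> {a..b} \<Longrightarrow> (\<lambda>n. f n s) \<longlonglongrightarrow> g s" and ab: "a \<le> b"
  shows "(\<lambda>n. chord_sum m (f n) a b) \<longlonglongrightarrow> chord_sum m g a b"
proof (cases "m = 0")
  case False
  define h where "h = (b - a) / m"
  have h: "0 \<le> h" "m * h = b - a" using False ab by (auto simp: h_def)
  have lim: "(\<lambda>n. f n (a + real k * h)) \<longlonglongrightarrow> g (a + real k * h)" if "k \<le> m" for k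
    using h mult_right_mono[of "real k" "real m" h] that by (intro f) auto
  show ?thesis
    unfolding chord_sum_def h_def[symmetric] by (intro tendsto_intros lim) auto
qed (simp add: chord_sum_def)

theorem theorem4:
  fixes q0 q1 :: "real^3"
  assumes "q1 \<in> causal_future q0"
  shows "\<exists>t1 q. optimal_trajectory t1 q q0 q1"
proof -
  let ?a = "q0 $ 2" and ?b = "q1 $ 2"
  define Len where "Len = {traj_length T q | T q. connects T q q0 q1}"
  obtain T0 p0 where p0: "connects T0 p0 q0 q1"
    using assms by (auto simp: causal_future_def connects_def)
  then have ne: "Len \<noteq> {}" by (auto simp: Len_def)
  have ab: "?a \<le> ?b" using trajectory_imp_profile[OF p0] by blast
  have bdd: "bdd_above Len"
  proof (rule bdd_aboveI)
    fix l assume "l \<in> Len"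
    then obtain T p where l: "l = traj_length T p" and p: "connects T p q0 q1"
      by (auto simp: Len_def)
    obtain f where "\<And>n. 0 < n \<Longrightarrow> traj_length T p \<le> chord_sum n f ?a ?b"
      by (rule trajectory_imp_profile[OF p]) blast
    from this[of 1] have "l \<le> sqrt ((?b - ?a)\<^sup>2 - (f (?a + (?b - ?a)) - f ?a)\<^sup>2)"
      by (simp add: chord_sum_def l)
    also have "\<dots> \<le> sqrt ((?b - ?a)\<^sup>2)"
      by (rule real_sqrt_le_mono) simp
    finally show "l \<le> ?b - ?a" using ab by simp
  qed
  have "\<exists>f. profile q0 q1 f \<and> (\<forall>m>0. Sup Len - 1 / real (Suc n) \<le> chord_sum m f ?a ?b)" for n
  proof -
    have "Sup Len - 1 / real (Suc n) < Sup Len" by simp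
    then obtain l where "l \<in> Len" "Sup Len - 1 / real (Suc n) < l"
      unfolding less_cSup_iff[OF ne bdd] by blast
    then obtain T p where p: "connects T p q0 q1" "Sup Len - 1 / real (Suc n) < traj_length T p"
      unfolding Len_def by blast
    obtain f where "profile q0 q1 f" "\<And>m. 0 < m \<Longrightarrow> traj_length T p \<le> chord_sum m f ?a ?b"
      by (rule trajectory_imp_profile[OF p(1)]) blast
    then show ?thesis using p(2) by (meson less_imp_le order_trans)
  qed
  then obtain f where f: "\<And>n. profile q0 q1 (f n)"
    "\<And>n m. 0 < m \<Longrightarrow> Sup Len - 1 / real (Suc n) \<le> chord_sum m (f n) ?a ?b"
    by metis
  obtain g r where g: "profile q0 q1 g" and r: "strict_mono (r :: nat \<Rightarrow> nat)"
    and lim: "\<And>s. s \<in> {?a..?b} \<Longrightarrow> (\<lambda>n. f (r n) s) \<longlonglongrightarrow> g s"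
    by (rule profiles_sequentially_compact[OF ab f(1)]) (rule that)
  \<comment> \<open>For fixed \<open>m\<close> the chord sum is continuous in the profile, so the bounds for the sequence pass to its limit.\<close>
  have sup_le: "Sup Len \<le> chord_sum m g ?a ?b" if "0 < m" for m
  proof (rule LIMSEQ_le[OF _ tendsto_chord_sum[OF lim ab]])
    have "(\<lambda>n. 1 / real (Suc n)) \<longlonglongrightarrow> 0"
      by (rule LIMSEQ_Suc[OF lim_const_over_n])
    from tendsto_diff[OF tendsto_const LIMSEQ_subseq_LIMSEQ[OF this r]]
    show "(\<lambda>n. Sup Len - 1 / real (Suc (r n))) \<longlonglongrightarrow> Sup Len"
      by (simp add: o_def)
  qed (use f(2)[OF that] in auto)
  obtain q where q: "connects (?b - ?a) q q0 q1"
    "(\<lambda>n. chord_sum (Suc n) g ?a ?b) \<longlonglongrightarrow> traj_length (?b - ?a) q"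
    by (rule profile_imp_trajectory[OF ab g]) (rule that)
  have "Sup Len \<le> traj_length (?b - ?a) q"
    using q(2) by (rule LIMSEQ_le_const) (use sup_le in auto)
  moreover have "traj_length T p \<le> Sup Len" if "connects T p q0 q1" for T p
    using that by (intro cSup_upper bdd) (auto simp: Len_def)
  ultimately have "optimal_trajectory (?b - ?a) q q0 q1"
    using q(1) unfolding optimal_trajectory_def by (blast intro: order_trans)
  then show ?thesis by blast
qed

end
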